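(* The numbers of $n\times n$ diagonally symmetric alternating sign matrices whose $1$ in the first row is in column $1$, $2$, $3$ or $n$ satisfy (i) $|\mathrm{DSASM}(n,1)|=|\mathrm{DSASM}(n-1)|$, (ii) $|\mathrm{DSASM}(n,2)|=|\mathrm{DSASM}(n-1)|$, (iii) $|\mathrm{DSASM}(n,n)|=|\mathrm{DSASM}(n-2)|$, (iv) $|\mathrm{DSASM}(n,3)|=2\,|\mathrm{DSASM}(n-1)|-3\,|\mathrm{DSASM}(n-2)|$, for $n\ge2$ in (i) and (ii), and $n\ge3$ in (iii) and (iv). Furthermore, (i)–(iii) can be generalized to the generating function identities (i$'$) $[t^1]\,X_n(r,s,t)=s\,X_{n-1}(r,s,1)$, (ii$'$) $[t^2]\,X_n(r,s,t)=rs\,X_{n-1}(r,s,1)+r\,(1-s^2)\,X_{n-2}(r,s,1)$, (iii$'$) $[t^n]\,X_n(r,s,t)=r\,X_{n-2}(r,s,1)$, for $n\ge2$ in (i$'$), and $n\ge3$ in (ii$'$) and (iii$'$).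
   Context: An alternating sign matrix (ASM) is a square matrix with entries in $\{0,1,-1\}$ such that along each row and each column the nonzero entries alternate in sign and have sum $1$. A diagonally symmetric ASM (DSASM) is an ASM which equals its transpose. $\mathrm{DSASM}(n)$ is the set of $n\times n$ DSASMs. For $A\in\mathrm{DSASM}(n)$ let $R(A)=\sum_{1\le i<j\le n}|A_{ij}|$, $S(A)=\sum_{i=1}^n|A_{ii}|$, and $T(A)=$ the column number of the unique $1$ in the first row of $A$. $\mathrm{DSASM}(n,k)=\{A\in\mathrm{DSASM}(n)\mid T(A)=k\}$. For indeterminates $r,s,t$, $X_n(r,s,t)=\sum_{A\in\mathrm{DSASM}(n)}r^{R(A)}s^{S(A)}t^{T(A)}$. $[t^k]$ denotes the coefficient of $t^k$. *)

theory Defs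
  imports "Jordan_Normal_Form.Matrix" "HOL-Computational_Algebra.Polynomial"
begin

definition alternating_sum_one :: "int list \<Rightarrow> bool" where
  "alternating_sum_one xs \<longleftrightarrow>
     successively (\<lambda>x y. sgn y = - sgn x) (filter (\<lambda>x. x \<noteq> 0) xs) \<and> sum_list xs = 1"

definition ASM :: "nat \<Rightarrow> int mat set" where
  "ASM n = {A \<in> carrier_mat n n.
     (\<forall>i<n. \<forall>j<n. A $$ (i, j) \<in> {0, 1, -1}) \<and>
     (\<forall>i<n. alternating_sum_one (list_of_vec (row A i))) \<and>
     (\<forall>j<n. alternating_sum_one (list_of_vec (col A j)))}"

definition DSASM :: "nat \<Rightarrow> int mat set" where
  "DSASM n = {A \<in> ASM n. transpose_mat A = A}"

definition R_stat :: "int mat \<Rightarrow> nat" where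
  "R_stat A = nat (\<Sum>j<dim_row A. \<Sum>i<j. \<bar>A $$ (i, j)\<bar>)"

definition S_stat :: "int mat \<Rightarrow> nat" where
  "S_stat A = nat (\<Sum>i<dim_row A. \<bar>A $$ (i, i)\<bar>)"

text \<open>Matrix indices start at 0, but columns are numbered from 1, hence the successor.
  The description is proper for an ASM of positive size: the first nonzero entry of every column
  is 1, so the first row has no entry -1 and exactly one entry 1.\<close>

definition T_stat :: "int mat \<Rightarrow> nat" where
  "T_stat A = Suc (THE j. j < dim_col A \<and> A $$ (0, j) = 1)"

definition DSASM_first :: "nat \<Rightarrow> nat \<Rightarrow> int mat set" where
  "DSASM_first n k = {A \<in> DSASM n. T_stat A = k}"

text \<open>The polynomial ring in the indeterminates \<open>r, s, t\<close> over the integers is represented as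
  the iterated ring \<open>\<int>[r][s][t]\<close>, with \<open>t\<close> outermost. So if \<open>p\<close> stands for \<open>p(r, s, t)\<close>, then
  \<open>coeff p k\<close> is the coefficient of \<open>t\<^sup>k\<close> and \<open>poly p 1\<close> is \<open>p(r, s, 1)\<close>, both in \<open>\<int>[r][s]\<close>.\<close>

definition indet_r :: "int poly poly" where
  "indet_r = [:[:0, 1:]:]"

definition indet_s :: "int poly poly" where
  "indet_s = [:0, 1:]"

definition indet_t :: "int poly poly poly" where
  "indet_t = [:0, 1:]"

definition X_gf :: "nat \<Rightarrow> int poly poly poly" where
  "X_gf n = (\<Sum>A\<in>DSASM n. [:indet_r:] ^ R_stat A * [:indet_s:] ^ S_stat A * indet_t ^ T_stat A)"

end

theory Submission
  imports Defs
begin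

text \<open>
  A symmetric integer matrix is a DSASM exactly when the partial sums of each row, taken from the
  left, lie in \<open>{0, 1}\<close> and each complete row sum is \<open>1\<close>. In this form the conditions are linear in
  the matrix, so they can be followed through the addition of a fixed correction matrix.

  If the \<open>1\<close> of the first row is in column \<open>k\<close> (counted from \<open>0\<close>), a DSASM is determined by the
  matrix \<open>M\<close> left after deleting the first row and column. That matrix is symmetric and satisfies
  the conditions of a DSASM, except that row \<open>k - 1\<close> has lost a leading \<open>1\<close>: its partial sums lie in
  \<open>{-1, 0}\<close> and its total is \<open>0\<close>. Such an \<open>M\<close> is called residual (\<open>bij_betw_border\<close>). The theorem
  comes from turning residual matrices back into DSASMs. Write \<open>E_ab\<close> for the matrix with
  a single \<open>1\<close> in place \<open>(a, b)\<close>.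

  \<^item> For \<open>k = 0\<close> nothing is missing, and \<open>M\<close> is a DSASM.

  \<^item> For \<open>k = 1\<close> the lost \<open>1\<close> is restored in the corner: \<open>M \<mapsto> M + E_00\<close> is a bijection onto all DSASMs of
    the size of \<open>M\<close> (\<open>bij_betw_residual_1\<close>).

  \<^item> If \<open>k\<close> is the last column, the last row of \<open>M\<close> is nonnegative by symmetry but has partial sums
    at most \<open>0\<close>. So it vanishes, and deleting it and the last column leaves a DSASM
    (\<open>bij_betw_zero_border\<close>).

  \<^item> For \<open>k = 2\<close> there are two cases. If \<open>M_01 = 0\<close>, then \<open>M \<mapsto> M + E_11\<close> is a bijection onto the
    DSASMs \<open>B\<close> with \<open>B_01 = 0\<close>, those whose first \<open>1\<close> is not in the second column. Otherwise the upper
    left corner of \<open>M\<close> begins with \<open>1, -1\<close>, and \<open>M \<mapsto> M + E_01 + E_10 - E_00\<close> is a bijection onto the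
    DSASMs with \<open>B_00 = B_01 = 0\<close>. With \<open>D(n) = |DSASM(n)|\<close>, the targets have
    \<open>D(n-1) - D(n-2)\<close> and \<open>D(n-1) - 2 D(n-2)\<close> elements by the first two cases, which add up to
    \<open>2 D(n-1) - 3 D(n-2)\<close>.

  The generating functions follow by recording the statistics along the first three bijections.
  Only for \<open>k = 1\<close> does the correction change one of them: adding \<open>E_00\<close> alters the number of nonzero
  diagonal entries by \<open>1\<close>, upwards if \<open>B_00 = 1\<close> and downwards if \<open>B_00 = 0\<close>.
\<close>

section \<open>Alternation as a bound on partial sums\<close>

text \<open>A walk with steps \<open>0, 1, -1\<close> that starts at \<open>s\<close> stays in \<open>{0, 1}\<close> exactly when its nonzero
  steps alternate and the first of them leads away from \<open>s\<close> into \<open>{0, 1}\<close>. A fictitious preceding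
  step \<open>2 s - 1\<close>, the one that would have led to \<open>s\<close> from the other point, expresses the latter
  requirement as alternation and makes the induction on the list go through.\<close>

lemma successively_sgn_iff_prefix_sums:
  fixes xs :: "int list" and s :: int
  assumes "set xs \<subseteq> {0, 1, -1}" "s \<in> {0, 1}"
  shows "successively (\<lambda>x y. sgn y = - sgn x) ((2 * s - 1) # filter (\<lambda>x. x \<noteq> 0) xs)
    \<longleftrightarrow> (\<forall>q\<le>length xs. s + sum_list (take q xs) \<in> {0, 1})"
  using assms
proof (induction xs arbitrary: s)
  case Nil
  then show ?case by simp
next
  case (Cons x xs)
  have split: "(\<forall>q\<le>length (x # xs). s + sum_list (take q (x # xs)) \<in> {0, 1})
    \<longleftrightarrow> (\<forall>q\<le>length xs. (s + x) + sum_list (take q xs) \<in> {0, 1})"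
    (is "?L \<longleftrightarrow> ?R")
  proof
    assume ?L
    show ?R
    proof (intro allI impI)
      fix q assume "q \<le> length xs"
      with \<open>?L\<close>[rule_format, of "Suc q"] show "(s + x) + sum_list (take q xs) \<in> {0, 1}"
        by (simp add: add.assoc)
    qed
  next
    assume ?R
    show ?L
    proof (intro allI impI)
      fix q assume "q \<le> length (x # xs)"
      with \<open>?R\<close>[rule_format, of "q - 1"] Cons.prems(2)
      show "s + sum_list (take q (x # xs)) \<in> {0, 1}"
        by (cases q) (simp_all add: add.assoc)
    qed
  qed
  consider "x = 0" | "x = 1 - 2 * s" | "x = 2 * s - 1"
    using Cons.prems by auto
  then show ?case
  proof cases
    case 1
    then show ?thesis unfolding split using Cons by simp
  next
    case 2
    then consider "s = 0" "x = 1" | "s = 1" "x = -1"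
      using Cons.prems(2) by auto
    then show ?thesis
      unfolding split using Cons.IH[of 1] Cons.IH[of 0] Cons.prems(1) by cases simp_all
  next
    case 3
    have "x \<noteq> 0" "sgn x \<noteq> - sgn (2 * s - 1)" "s + x \<notin> {0, 1}"
      using 3 Cons.prems(2) by auto
    moreover from this have "\<not> ?R"
      by (auto dest: spec[of _ 0])
    ultimately show ?thesis unfolding split by simp
  qed
qed

text \<open>Here the walk starts at \<open>0\<close>, so the fictitious preceding step is \<open>-1\<close>. It imposes that the first
  nonzero entry be \<open>1\<close>, which the total \<open>1\<close> forces anyway: an alternating sequence starting with \<open>-1\<close>
  has total at most \<open>0\<close>.\<close>

lemma alternating_sum_one_iff_prefix_sums:
  assumes "set xs \<subseteq> {0, 1, -1}"
  shows "alternating_sum_one xs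
    \<longleftrightarrow> (\<forall>q\<le>length xs. sum_list (take q xs) \<in> {0, 1}) \<and> sum_list xs = 1"
proof -
  let ?P = "\<lambda>x y :: int. sgn y = - sgn x" and ?ys = "filter (\<lambda>x. x \<noteq> 0) xs"
  have "successively ?P ?ys \<longleftrightarrow> successively ?P (- 1 # ?ys)" if sum: "sum_list xs = 1"
  proof (cases ?ys)
    case Nil
    then show ?thesis by simp
  next
    case (Cons y ys)
    have "y \<in> set ?ys" by (simp add: Cons)
    then consider "y = 1" | "y = -1" using assms by auto
    then show ?thesis
    proof cases
      case 1
      then show ?thesis by (simp add: Cons)
    next
      case 2
      have "\<not> successively ?P (1 # ?ys)"
        using successively_sgn_iff_prefix_sums[OF assms, of 1] sum by auto
      then show ?thesis using 2 by (simp add: Cons)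
    qed
  qed
  then show ?thesis
    using successively_sgn_iff_prefix_sums[OF assms, of 0]
    by (auto simp: alternating_sum_one_def)
qed

definition row_prefix :: "int mat \<Rightarrow> nat \<Rightarrow> nat \<Rightarrow> int" where
  "row_prefix M i q = (\<Sum>j<q. M $$ (i, j))"

text \<open>The matrices left after deleting the first row and column of a DSASM of size \<open>m + 1\<close> whose first
  row has its \<open>1\<close> in column \<open>k\<close>, columns being numbered from \<open>0\<close>. Row \<open>i\<close> of the residual matrix comes
  from row \<open>Suc i\<close>, and \<open>of_bool (Suc i = k)\<close> is the entry that this row loses. For \<open>k = 0\<close> no row
  loses anything, so DSASMs are themselves a case of the definition.\<close>

definition residual_DSASM :: "nat \<Rightarrow> nat \<Rightarrow> int mat set" where
  "residual_DSASM m k = {M \<in> carrier_mat m m.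
     (\<forall>i<m. \<forall>j<m. M $$ (i, j) = M $$ (j, i)) \<and>
     (\<forall>i<m. \<forall>q\<le>m. of_bool (Suc i = k) + row_prefix M i q \<in> {0, 1}) \<and>
     (\<forall>i<m. of_bool (Suc i = k) + row_prefix M i m = 1)}"

lemma residual_DSASM_symD:
  "M \<in> residual_DSASM m k \<Longrightarrow> i < m \<Longrightarrow> j < m \<Longrightarrow> M $$ (i, j) = M $$ (j, i)"
  by (auto simp: residual_DSASM_def)

lemma residual_DSASM_prefixD:
  "M \<in> residual_DSASM m k \<Longrightarrow> i < m \<Longrightarrow> q \<le> m \<Longrightarrow>
    of_bool (Suc i = k) + row_prefix M i q \<in> {0, 1}"
  by (auto simp: residual_DSASM_def)

lemma residual_DSASM_totalD:
  "M \<in> residual_DSASM m k \<Longrightarrow> i < m \<Longrightarrow> of_bool (Suc i = k) + row_prefix M i m = 1"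
  by (auto simp: residual_DSASM_def)

lemma row_prefix_0 [simp]: "row_prefix M i 0 = 0"
  by (simp add: row_prefix_def)

lemma row_prefix_Suc: "row_prefix M i (Suc q) = row_prefix M i q + M $$ (i, q)"
  by (simp add: row_prefix_def)

lemma sum_list_take_row:
  assumes "M \<in> carrier_mat m m" "i < m" "q \<le> m"
  shows "sum_list (take q (list_of_vec (row M i))) = row_prefix M i q"
proof -
  have "take q (list_of_vec (row M i)) = map (\<lambda>j. M $$ (i, j)) [0..<q]"
    using assms by (intro nth_equalityI) (auto simp: list_of_vec_index)
  then show ?thesis
    by (simp add: row_prefix_def interv_sum_list_conv_sum_set_nat atLeast0LessThan)
qed

lemma entry_eq_row_prefix_diff: "M $$ (i, j) = row_prefix M i (Suc j) - row_prefix M i j"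
  by (simp add: row_prefix_Suc)

text \<open>By symmetry the conditions on the columns repeat those on the rows, and entries in \<open>{0, 1, -1}\<close>
  are automatic as differences of consecutive partial sums.\<close>

lemma DSASM_eq_residual: "DSASM m = residual_DSASM m 0"
proof (rule Set.set_eqI)
  fix M
  show "M \<in> DSASM m \<longleftrightarrow> M \<in> residual_DSASM m 0"
  proof (cases "M \<in> carrier_mat m m")
    case False
    then show ?thesis by (auto simp: DSASM_def ASM_def residual_DSASM_def)
  next
    case M: True
    have sym: "transpose_mat M = M \<longleftrightarrow> (\<forall>i<m. \<forall>j<m. M $$ (i, j) = M $$ (j, i))"
      using M by (auto simp: mat_eq_iff)
    have row: "alternating_sum_one (list_of_vec (row M i))
      \<longleftrightarrow> (\<forall>q\<le>m. row_prefix M i q \<in> {0, 1}) \<and> row_prefix M i m = 1"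
      if "i < m" "\<forall>j<m. M $$ (i, j) \<in> {0, 1, -1}" for i
    proof -
      have len: "length (list_of_vec (row M i)) = m" using M by simp
      have "set (list_of_vec (row M i)) \<subseteq> {0, 1, -1}"
        using M that by (fastforce simp: in_set_conv_nth list_of_vec_index)
      note alternating_sum_one_iff_prefix_sums[OF this, unfolded len]
      moreover have "sum_list (list_of_vec (row M i)) = row_prefix M i m"
        using sum_list_take_row[OF M \<open>i < m\<close>, of m] len by simp
      ultimately show ?thesis
        using sum_list_take_row[OF M \<open>i < m\<close>] by simp
    qed
    have col: "col M i = row M i" if "transpose_mat M = M" "i < m" for i
      using that M by (metis carrier_matD(1) row_transpose col_transpose)
    have ent: "\<forall>j<m. M $$ (i, j) \<in> {0, 1, -1}"
      if "\<forall>q\<le>m. row_prefix M i q \<in> {0, 1}" for i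
    proof (intro allI impI)
      fix j assume "j < m"
      then have "row_prefix M i (Suc j) \<in> {0, 1}" "row_prefix M i j \<in> {0, 1}"
        using that by simp_all
      then show "M $$ (i, j) \<in> {0, 1, -1}"
        unfolding entry_eq_row_prefix_diff[of M i j] by auto
    qed
    show ?thesis
    proof
      assume "M \<in> DSASM m"
      then show "M \<in> residual_DSASM m 0"
        using M row sym by (simp add: DSASM_def ASM_def residual_DSASM_def)
    next
      assume "M \<in> residual_DSASM m 0"
      then have *: "\<forall>i<m. \<forall>q\<le>m. row_prefix M i q \<in> {0, 1}" "\<forall>i<m. row_prefix M i m = 1"
        and tr: "transpose_mat M = M"
        using sym by (auto simp: residual_DSASM_def)
      then show "M \<in> DSASM m"
        using M row ent col by (simp add: DSASM_def ASM_def)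
    qed
  qed
qed

lemma finite_DSASM: "finite (DSASM n)"
proof (rule finite_subset)
  let ?F = "({..<n} \<times> {..<n}) \<rightarrow>\<^sub>E {0, 1, -1 :: int}"
  show "DSASM n \<subseteq> (\<lambda>f. mat n n f) ` ?F"
  proof
    fix A assume A: "A \<in> DSASM n"
    let ?f = "restrict (\<lambda>ij. A $$ ij) ({..<n} \<times> {..<n})"
    have "A = mat n n ?f" "?f \<in> ?F"
      using A by (auto simp: DSASM_def ASM_def PiE_iff)
    then show "A \<in> (\<lambda>f. mat n n f) ` ?F" by blast
  qed
  show "finite ((\<lambda>f. mat n n f) ` ?F)" by (intro finite_imageI finite_PiE) auto
qed

section \<open>Deleting the first row and column\<close>

text \<open>By symmetry an entry \<open>(0, j)\<close> equals \<open>(j, 0)\<close>, the first partial sum of row \<open>j\<close>, hence is \<open>0\<close> or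
  \<open>1\<close>. Since the row sum is \<open>1\<close>, exactly one of them is \<open>1\<close>.\<close>

lemma DSASM_first_row:
  assumes "A \<in> DSASM n" "0 < n"
  obtains k where "k < n" "\<And>j. j < n \<Longrightarrow> A $$ (0, j) = of_bool (j = k)"
proof -
  from assms have A: "A \<in> residual_DSASM n 0" by (simp add: DSASM_eq_residual)
  have ent: "A $$ (0, j) \<in> {0, 1}" if "j < n" for j
  proof -
    have "A $$ (0, j) = row_prefix A j 1"
      using residual_DSASM_symD[OF A assms(2) that] by (simp add: row_prefix_def)
    then show ?thesis
      using residual_DSASM_prefixD[OF A that, of 1] assms(2) by simp
  qed
  let ?J = "{j. j < n \<and> A $$ (0, j) = 1}"
  have "1 = (\<Sum>j<n. A $$ (0, j))"
    using residual_DSASM_totalD[OF A assms(2)] by (simp add: row_prefix_def)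
  also have "\<dots> = (\<Sum>j<n. of_bool (A $$ (0, j) = 1))"
    using ent by (intro sum.cong) auto
  also have "\<dots> = int (card ({..<n} \<inter> {j. A $$ (0, j) = 1}))"
    by (subst sum_of_bool_eq) auto
  also have "{..<n} \<inter> {j. A $$ (0, j) = 1} = ?J" by auto
  finally have "card ?J = 1" by simp
  then obtain k where "?J = {k}" by (rule card_1_singletonE)
  then show thesis using ent that[of k] by force
qed

lemma T_stat_eq:
  assumes "A \<in> carrier_mat n n" "k < n" "\<And>j. j < n \<Longrightarrow> A $$ (0, j) = of_bool (j = k)"
  shows "T_stat A = Suc k"
  using assms by (auto simp: T_stat_def intro!: the_equality)

lemma DSASM_first_iff:
  assumes "k < n"
  shows "A \<in> DSASM_first n (Suc k)
    \<longleftrightarrow> A \<in> DSASM n \<and> (\<forall>j<n. A $$ (0, j) = of_bool (j = k))"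
proof (cases "A \<in> DSASM n")
  case True
  moreover from True have "A \<in> carrier_mat n n" by (simp add: DSASM_def ASM_def)
  ultimately show ?thesis
    using assms DSASM_first_row[OF True] T_stat_eq[of A n]
    by (smt (verit) DSASM_first_def mem_Collect_eq less_nat_zero_code nat.inject not_gr_zero)
qed (simp add: DSASM_first_def)

lemma DSASM_first_iff_entry:
  assumes "k < n" "A \<in> DSASM n"
  shows "A \<in> DSASM_first n (Suc k) \<longleftrightarrow> A $$ (0, k) = 1"
    and "A $$ (0, k) \<in> {0, 1}"
proof -
  obtain l where "l < n" and l: "\<And>j. j < n \<Longrightarrow> A $$ (0, j) = of_bool (j = l)"
    using DSASM_first_row[of A n] assms by auto
  then show "A \<in> DSASM_first n (Suc k) \<longleftrightarrow> A $$ (0, k) = 1" "A $$ (0, k) \<in> {0, 1}"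
    using assms by (auto simp: DSASM_first_iff)
qed

definition border :: "nat \<Rightarrow> int mat \<Rightarrow> int mat" where
  "border k M = mat (Suc (dim_row M)) (Suc (dim_col M)) (\<lambda>(i, j).
     if i = 0 then of_bool (j = k) else if j = 0 then of_bool (i = k)
     else M $$ (i - 1, j - 1))"

definition minor :: "int mat \<Rightarrow> int mat" where
  "minor A = mat (dim_row A - 1) (dim_col A - 1) (\<lambda>(i, j). A $$ (Suc i, Suc j))"

lemma border_in_carrier [simp]:
  "M \<in> carrier_mat m m \<Longrightarrow> border k M \<in> carrier_mat (Suc m) (Suc m)"
  by (simp add: border_def)

lemma border_index:
  assumes "M \<in> carrier_mat m m"
  shows "j \<le> m \<Longrightarrow> border k M $$ (0, j) = of_bool (j = k)"
    and "i < m \<Longrightarrow> border k M $$ (Suc i, 0) = of_bool (Suc i = k)"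
    and "i < m \<Longrightarrow> j < m \<Longrightarrow> border k M $$ (Suc i, Suc j) = M $$ (i, j)"
  using assms by (auto simp: border_def)

lemma row_prefix_border_0:
  assumes "M \<in> carrier_mat m m" "q \<le> Suc m"
  shows "row_prefix (border k M) 0 q = of_bool (k < q)"
  using assms(2)
  by (induction q) (auto simp: row_prefix_Suc border_index(1)[OF assms(1)] less_Suc_eq)

lemma row_prefix_border_Suc:
  assumes "M \<in> carrier_mat m m" "i < m" "q \<le> m"
  shows "row_prefix (border k M) (Suc i) (Suc q) = of_bool (Suc i = k) + row_prefix M i q"
  using assms(3)
  by (induction q) (auto simp: row_prefix_Suc border_index[OF assms(1)] assms(2))

text \<open>Each partial sum of row \<open>Suc i\<close> of the bordered matrix is the bordering entry plus a partial sum of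
  row \<open>i\<close> of the inner matrix, and the new first row satisfies the conditions whenever its \<open>1\<close> lies
  inside the matrix.\<close>

lemma border_in_DSASM_iff:
  assumes M: "M \<in> carrier_mat m m" and "k \<le> m"
  shows "border k M \<in> DSASM (Suc m) \<longleftrightarrow> M \<in> residual_DSASM m k"
proof -
  let ?A = "border k M"
  have "(\<forall>i<Suc m. \<forall>j<Suc m. ?A $$ (i, j) = ?A $$ (j, i))
    \<longleftrightarrow> (\<forall>i<m. \<forall>j<m. M $$ (i, j) = M $$ (j, i))"
    using border_index[OF M] by (simp add: All_less_Suc2)
  moreover have "(\<forall>i<Suc m. \<forall>q\<le>Suc m. row_prefix ?A i q \<in> {0, 1})
    \<longleftrightarrow> (\<forall>i<m. \<forall>q\<le>m. of_bool (Suc i = k) + row_prefix M i q \<in> {0, 1})"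
  proof -
    have "(\<forall>q\<le>Suc m. row_prefix ?A (Suc i) q \<in> {0, 1})
      \<longleftrightarrow> (\<forall>q\<le>m. of_bool (Suc i = k) + row_prefix M i q \<in> {0, 1})" if "i < m" for i
    proof -
      have "(\<forall>q\<le>Suc m. P q) \<longleftrightarrow> P 0 \<and> (\<forall>q\<le>m. P (Suc q))" for P
        using All_less_Suc2[of "Suc m" P] by (simp only: less_Suc_eq_le)
      from this[of "\<lambda>q. row_prefix ?A (Suc i) q \<in> {0, 1}"] show ?thesis
        by (simp add: row_prefix_border_Suc[OF M that])
    qed
    moreover have "\<forall>q\<le>Suc m. row_prefix ?A 0 q \<in> {0, 1}"
      by (simp add: row_prefix_border_0[OF M])
    ultimately show ?thesis by (simp only: All_less_Suc2) auto
  qed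
  moreover have "(\<forall>i<Suc m. row_prefix ?A i (Suc m) = 1)
    \<longleftrightarrow> (\<forall>i<m. of_bool (Suc i = k) + row_prefix M i m = 1)"
    using row_prefix_border_0[OF M] row_prefix_border_Suc[OF M] \<open>k \<le> m\<close>
    by (simp add: All_less_Suc2)
  ultimately show ?thesis
    using M by (simp add: DSASM_eq_residual residual_DSASM_def)
qed

lemma bij_betw_border:
  assumes "k \<le> m"
  shows "bij_betw (border k) (residual_DSASM m k) (DSASM_first (Suc m) (Suc k))"
proof (rule bij_betwI[where g = minor])
  have car: "M \<in> carrier_mat m m" if "M \<in> residual_DSASM m k" for M
    using that by (simp add: residual_DSASM_def)
  show "border k \<in> residual_DSASM m k \<rightarrow> DSASM_first (Suc m) (Suc k)"
  proof
    fix M assume M: "M \<in> residual_DSASM m k"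
    then show "border k M \<in> DSASM_first (Suc m) (Suc k)"
      using assms border_in_DSASM_iff[OF car[OF M]] border_index(1)[OF car[OF M]]
      by (simp add: DSASM_first_iff)
  qed
  have inv: "minor A \<in> carrier_mat m m \<and> border k (minor A) = A"
    if A: "A \<in> DSASM_first (Suc m) (Suc k)" for A
  proof
    have D: "A \<in> DSASM (Suc m)" and row0: "\<forall>j<Suc m. A $$ (0, j) = of_bool (j = k)"
      using A assms DSASM_first_iff[of k "Suc m" A] by auto
    then have C: "A \<in> carrier_mat (Suc m) (Suc m)"
      and sym: "\<forall>i<Suc m. \<forall>j<Suc m. A $$ (i, j) = A $$ (j, i)"
      by (auto simp: DSASM_eq_residual residual_DSASM_def)
    show mC: "minor A \<in> carrier_mat m m" using C by (simp add: minor_def)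
    show "border k (minor A) = A"
      using C mC row0 sym
      by (intro eq_matI) (auto simp: border_def minor_def)
  qed
  show "minor \<in> DSASM_first (Suc m) (Suc k) \<rightarrow> residual_DSASM m k"
  proof
    fix A assume A: "A \<in> DSASM_first (Suc m) (Suc k)"
    then have "A \<in> DSASM (Suc m)" by (simp add: DSASM_first_def)
    then show "minor A \<in> residual_DSASM m k"
      using inv[OF A] border_in_DSASM_iff[of "minor A" m k] assms by simp
  qed
  show "border k (minor A) = A" if "A \<in> DSASM_first (Suc m) (Suc k)" for A
    using inv[OF that] by simp
  show "minor (border k M) = M" if "M \<in> residual_DSASM m k" for M
    using car[OF that] by (intro eq_matI) (auto simp: minor_def border_def)
qed

lemma finite_residual_DSASM: "k \<le> m \<Longrightarrow> finite (residual_DSASM m k)"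
  using bij_betw_finite[OF bij_betw_border, of k m] finite_DSASM[of "Suc m"]
  by (simp add: DSASM_first_def)

section \<open>Correcting residual matrices\<close>

definition elem_mat :: "nat \<Rightarrow> nat \<Rightarrow> nat \<Rightarrow> int mat" where
  "elem_mat m a b = mat m m (\<lambda>(i, j). of_bool (i = a \<and> j = b))"

lemma elem_mat_carrier [simp]: "elem_mat m a b \<in> carrier_mat m m"
  by (simp add: elem_mat_def)

lemma elem_mat_index [simp]:
  "i < m \<Longrightarrow> j < m \<Longrightarrow> elem_mat m a b $$ (i, j) = of_bool (i = a \<and> j = b)"
  by (simp add: elem_mat_def)

lemma elem_mat_dim [simp]: "dim_row (elem_mat m a b) = m" "dim_col (elem_mat m a b) = m"
  by (simp_all add: elem_mat_def)

lemma row_prefix_elem_mat: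
  "i < m \<Longrightarrow> q \<le> m \<Longrightarrow> row_prefix (elem_mat m a b) i q = of_bool (i = a \<and> b < q)"
  by (induction q) (auto simp: row_prefix_Suc less_Suc_eq)

lemma row_prefix_add:
  assumes "i < dim_row E" "q \<le> dim_col E"
  shows "row_prefix (M + E) i q = row_prefix M i q + row_prefix E i q"
  using assms by (simp add: row_prefix_def sum.distrib)

lemma row_prefix_diff:
  assumes "i < dim_row E" "q \<le> dim_col E"
  shows "row_prefix (M - E) i q = row_prefix M i q - row_prefix E i q"
  using assms by (simp add: row_prefix_def sum_subtractf)

text \<open>Since partial sums are additive, a symmetric correction \<open>E\<close> turns residual matrices into DSASMs as
  soon as its row sums replace the lost entry and the bounds on partial sums correspond. In one of
  the applications this correspondence uses the symmetry of \<open>M\<close>, which may therefore be assumed.\<close>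

lemma residual_add_iff:
  fixes M E :: "int mat"
  assumes M: "M \<in> carrier_mat m m" and E: "E \<in> carrier_mat m m"
    and symE: "\<And>i j. i < m \<Longrightarrow> j < m \<Longrightarrow> E $$ (i, j) = E $$ (j, i)"
    and prefix: "\<And>i q. (\<And>i j. i < m \<Longrightarrow> j < m \<Longrightarrow> M $$ (i, j) = M $$ (j, i)) \<Longrightarrow> i < m \<Longrightarrow> q \<le> m \<Longrightarrow>
      of_bool (Suc i = k) + row_prefix M i q \<in> {0, 1} \<longleftrightarrow> row_prefix (M + E) i q \<in> {0, 1}"
    and total: "\<And>i. i < m \<Longrightarrow> row_prefix E i m = of_bool (Suc i = k)"
  shows "M \<in> residual_DSASM m k \<longleftrightarrow> M + E \<in> DSASM m"
proof -
  have "(M + E) $$ (i, j) = (M + E) $$ (j, i) \<longleftrightarrow> M $$ (i, j) = M $$ (j, i)"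
    if "i < m" "j < m" for i j
    using M E symE[OF that] that by simp
  then have sym: "(\<forall>i<m. \<forall>j<m. (M + E) $$ (i, j) = (M + E) $$ (j, i))
    \<longleftrightarrow> (\<forall>i<m. \<forall>j<m. M $$ (i, j) = M $$ (j, i))" by blast
  have tot: "row_prefix (M + E) i m = of_bool (Suc i = k) + row_prefix M i m" if "i < m" for i
    using that total E by (simp add: row_prefix_add)
  show ?thesis
  proof (cases "\<forall>i<m. \<forall>j<m. M $$ (i, j) = M $$ (j, i)")
    case False
    then have "M \<notin> residual_DSASM m k" using residual_DSASM_symD[of M m k] by blast
    moreover have "M + E \<notin> DSASM m"
      using False sym residual_DSASM_symD[of "M + E" m 0] unfolding DSASM_eq_residual by blast
    ultimately show ?thesis by simp
  next
    case True
    then have "of_bool (Suc i = k) + row_prefix M i q \<in> {0, 1} \<longleftrightarrow> row_prefix (M + E) i q \<in> {0, 1}"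
      if "i < m" "q \<le> m" for i q
      using that by (intro prefix) auto
    then have "(\<forall>i<m. \<forall>q\<le>m. of_bool (Suc i = k) + row_prefix M i q \<in> {0, 1})
      \<longleftrightarrow> (\<forall>i<m. \<forall>q\<le>m. row_prefix (M + E) i q \<in> {0, 1})" by blast
    moreover have "(\<forall>i<m. of_bool (Suc i = k) + row_prefix M i m = 1)
      \<longleftrightarrow> (\<forall>i<m. row_prefix (M + E) i m = 1)" using tot by simp
    moreover have "M + E \<in> carrier_mat m m" using E by simp
    ultimately show ?thesis
      unfolding DSASM_eq_residual residual_DSASM_def mem_Collect_eq sym
      using M by simp
  qed
qed

lemma bij_betw_add_mat:
  fixes E :: "int mat"
  assumes "X \<subseteq> carrier_mat m m" "Y \<subseteq> carrier_mat m m" "E \<in> carrier_mat m m"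
    and "\<And>M. M \<in> carrier_mat m m \<Longrightarrow> M \<in> X \<longleftrightarrow> M + E \<in> Y"
  shows "bij_betw (\<lambda>M. M + E) X Y"
proof (rule bij_betwI[where g = "\<lambda>B. B - E"])
  show "(\<lambda>M. M + E) \<in> X \<rightarrow> Y" using assms by blast
  have sub_add: "B - E \<in> carrier_mat m m \<and> (B - E) + E = B" if "B \<in> carrier_mat m m" for B
    using that assms(3) by (auto intro!: eq_matI)
  show "(\<lambda>B. B - E) \<in> Y \<rightarrow> X"
  proof
    fix B assume "B \<in> Y"
    with assms(2) sub_add have "B - E \<in> carrier_mat m m" "(B - E) + E = B" by blast+
    then show "B - E \<in> X" using assms(4)[of "B - E"] \<open>B \<in> Y\<close> by simp
  qed
  show "(B - E) + E = B" if "B \<in> Y" for B using sub_add that assms(2) by blast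
  show "(M + E) - E = M" if "M \<in> X" for M
    using that assms(1,3) by (auto intro!: eq_matI)
qed


lemma row_prefix_1: "row_prefix M i 1 = M $$ (i, 0)"
  by (simp add: row_prefix_def)

lemma row_prefix_2: "row_prefix M i 2 = M $$ (i, 0) + M $$ (i, 1)"
  by (simp add: row_prefix_def numeral_2_eq_2)

text \<open>In row \<open>0\<close> the lost \<open>1\<close> stood before all other entries, so adding \<open>1\<close> to the first of these restores
  every nonempty partial sum.\<close>

lemma bij_betw_residual_1:
  assumes "0 < m"
  shows "bij_betw (\<lambda>M. M + elem_mat m 0 0) (residual_DSASM m 1) (DSASM m)"
proof (rule bij_betw_add_mat)
  fix M :: "int mat" assume M: "M \<in> carrier_mat m m"
  show "M \<in> residual_DSASM m 1 \<longleftrightarrow> M + elem_mat m 0 0 \<in> DSASM m"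
  proof (rule residual_add_iff[OF M])
    fix i q assume "i < m" "q \<le> m"
    then show "of_bool (Suc i = 1) + row_prefix M i q \<in> {0, 1}
        \<longleftrightarrow> row_prefix (M + elem_mat m 0 0) i q \<in> {0, 1}"
      using M by (cases q) (auto simp: row_prefix_add row_prefix_elem_mat)
  qed (use assms in \<open>auto simp: row_prefix_elem_mat\<close>)
qed (auto simp: residual_DSASM_def DSASM_eq_residual)

text \<open>The \<open>1\<close> lost by row \<open>1\<close> stood before its first entry and is restored in its second. The only
  nonempty partial sum that misses it is the one of length \<open>1\<close>, which is \<open>M_10 = M_01 = 0\<close> and thus
  satisfies the bounds for residual matrices as well as those for DSASMs.\<close>

lemma bij_betw_residual_2_zero:
  assumes "2 \<le> m"
  shows "bij_betw (\<lambda>M. M + elem_mat m 1 1)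
    {M \<in> residual_DSASM m 2. M $$ (0, 1) = 0} {B \<in> DSASM m. B $$ (0, 1) = 0}"
proof (rule bij_betw_add_mat)
  fix M :: "int mat" assume M: "M \<in> carrier_mat m m"
  let ?B = "M + elem_mat m 1 1"
  have "M \<in> residual_DSASM m 2 \<longleftrightarrow> ?B \<in> DSASM m" if zero: "M $$ (0, 1) = 0"
  proof (rule residual_add_iff[OF M])
    fix i q assume sym: "\<And>i j. i < m \<Longrightarrow> j < m \<Longrightarrow> M $$ (i, j) = M $$ (j, i)"
      and iq: "i < m" "q \<le> m"
    have one: "row_prefix M 1 1 = 0"
      using sym[of 1 0] zero assms by (simp add: row_prefix_def)
    have add: "row_prefix ?B i q = row_prefix M i q + of_bool (i = 1 \<and> 1 < q)"
      using iq M by (simp add: row_prefix_add row_prefix_elem_mat)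
    consider "q = 0" | "q = 1" | "1 < q" by linarith
    then show "of_bool (Suc i = 2) + row_prefix M i q \<in> {0, 1}
        \<longleftrightarrow> row_prefix ?B i q \<in> {0, 1}"
      using one add by cases auto
  qed (use assms in \<open>auto simp: row_prefix_elem_mat\<close>)
  moreover have "?B $$ (0, 1) = M $$ (0, 1)" using M assms by simp
  ultimately show "M \<in> {M \<in> residual_DSASM m 2. M $$ (0, 1) = 0}
      \<longleftrightarrow> ?B \<in> {B \<in> DSASM m. B $$ (0, 1) = 0}"
    by auto
qed (auto simp: residual_DSASM_def DSASM_eq_residual)

text \<open>The entry \<open>M_10 = M_01\<close> is the first partial sum of the deficient row, hence \<open>-1\<close> if it is nonzero.
  In row \<open>0\<close> a \<open>-1\<close> in second place must be preceded by \<open>1\<close>.\<close>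

lemma residual_2_corner:
  assumes M: "M \<in> residual_DSASM m 2" and "2 \<le> m" "M $$ (0, 1) \<noteq> 0"
  shows "M $$ (0, 0) = 1" "M $$ (0, 1) = -1"
proof -
  have "row_prefix M 0 1 \<in> {0, 1}" "row_prefix M 0 2 \<in> {0, 1}" "1 + row_prefix M 1 1 \<in> {0, 1}"
    using assms residual_DSASM_prefixD[OF M, of 0] residual_DSASM_prefixD[OF M, of 1 1]
    by auto
  moreover have "M $$ (1, 0) = M $$ (0, 1)"
    using residual_DSASM_symD[OF M, of 1 0] assms by simp
  ultimately show "M $$ (0, 0) = 1" "M $$ (0, 1) = -1"
    using assms(3) unfolding row_prefix_1 row_prefix_2 by auto
qed

text \<open>The first two entries \<open>1, -1\<close> of row \<open>0\<close> become \<open>0, 0\<close>, which lowers only its partial sum of length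
  \<open>1\<close>, from \<open>1\<close> to \<open>0\<close>; and in row \<open>1\<close> the lost \<open>1\<close> is added to the first entry \<open>-1\<close>. The correction
  is thus valid for every matrix with corner entry \<open>1\<close>. On both sides of the bijection the
  corner entry of \<open>M\<close> is \<open>1\<close>, so this covers all cases.\<close>

lemma bij_betw_residual_2_nonzero:
  assumes "2 \<le> m"
  shows "bij_betw (\<lambda>M. M + (elem_mat m 0 1 + elem_mat m 1 0 - elem_mat m 0 0))
    {M \<in> residual_DSASM m 2. M $$ (0, 1) \<noteq> 0}
    {B \<in> DSASM m. B $$ (0, 0) = 0 \<and> B $$ (0, 1) = 0}"
proof (rule bij_betw_add_mat)
  let ?E = "elem_mat m 0 1 + elem_mat m 1 0 - elem_mat m 0 0"
  show E: "?E \<in> carrier_mat m m" by (rule minus_carrier_mat) simp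
  have prefixE: "row_prefix ?E i q
      = of_bool (i = 0 \<and> 1 < q) + of_bool (i = 1 \<and> 0 < q) - of_bool (i = 0 \<and> 0 < q)"
    if "i < m" "q \<le> m" for i q
    using that by (simp add: row_prefix_diff row_prefix_add row_prefix_elem_mat)
  fix M :: "int mat" assume M: "M \<in> carrier_mat m m"
  have "M \<in> residual_DSASM m 2 \<longleftrightarrow> M + ?E \<in> DSASM m" if corner: "M $$ (0, 0) = 1"
  proof (rule residual_add_iff[OF M E])
    fix i q assume iq: "i < m" "q \<le> m"
    have one: "row_prefix M 0 1 = 1" using corner by (simp add: row_prefix_def)
    have add: "row_prefix (M + ?E) i q = row_prefix M i q
        + (of_bool (i = 0 \<and> 1 < q) + of_bool (i = 1 \<and> 0 < q) - of_bool (i = 0 \<and> 0 < q))"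
      using prefixE[OF iq] iq by (simp add: row_prefix_add)
    consider "q = 0" | "q = 1" | "1 < q" by linarith
    then show "of_bool (Suc i = 2) + row_prefix M i q \<in> {0, 1}
        \<longleftrightarrow> row_prefix (M + ?E) i q \<in> {0, 1}"
      using one add by cases auto
  qed (use assms prefixE in auto)
  moreover have "(M + ?E) $$ (0, 0) = M $$ (0, 0) - 1" "(M + ?E) $$ (0, 1) = M $$ (0, 1) + 1"
    using M assms by auto
  ultimately show "M \<in> {M \<in> residual_DSASM m 2. M $$ (0, 1) \<noteq> 0}
      \<longleftrightarrow> M + ?E \<in> {B \<in> DSASM m. B $$ (0, 0) = 0 \<and> B $$ (0, 1) = 0}"
    using residual_2_corner[OF _ assms, of M] by (simp del: index_add_mat) force
qed (auto simp: residual_DSASM_def DSASM_eq_residual)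

definition zero_border :: "int mat \<Rightarrow> int mat" where
  "zero_border B = mat (Suc (dim_row B)) (Suc (dim_col B)) (\<lambda>(i, j).
     if i < dim_row B \<and> j < dim_col B then B $$ (i, j) else 0)"

lemma row_prefix_cong:
  "(\<And>j. j < q \<Longrightarrow> M $$ (i, j) = N $$ (i, j)) \<Longrightarrow> row_prefix M i q = row_prefix N i q"
  by (simp add: row_prefix_def)

lemma zero_border_index:
  assumes "B \<in> carrier_mat m m"
  shows "i < m \<Longrightarrow> j < m \<Longrightarrow> zero_border B $$ (i, j) = B $$ (i, j)"
    and "i \<le> m \<Longrightarrow> zero_border B $$ (i, m) = 0"
    and "i \<le> m \<Longrightarrow> zero_border B $$ (m, i) = 0"
  using assms by (auto simp: zero_border_def)

lemma row_prefix_zero_border: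
  assumes B: "B \<in> carrier_mat m m"
  shows "i < m \<Longrightarrow> q \<le> m \<Longrightarrow> row_prefix (zero_border B) i q = row_prefix B i q"
    and "i < m \<Longrightarrow> row_prefix (zero_border B) i (Suc m) = row_prefix B i m"
    and "q \<le> Suc m \<Longrightarrow> row_prefix (zero_border B) m q = 0"
proof -
  show *: "row_prefix (zero_border B) i q = row_prefix B i q" if "i < m" "q \<le> m" for q
    using that by (intro row_prefix_cong) (simp add: zero_border_index(1)[OF B])
  show "row_prefix (zero_border B) i (Suc m) = row_prefix B i m" if "i < m"
    using that * by (simp add: row_prefix_Suc zero_border_index(2)[OF B])
  show "row_prefix (zero_border B) m q = 0" if "q \<le> Suc m"
    using that by (simp add: row_prefix_def zero_border_index(3)[OF B])
qed

text \<open>Entry \<open>(m, j)\<close> with \<open>j < m\<close> equals \<open>(j, m)\<close>, the last entry of a row with partial sums in \<open>{0, 1}\<close>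
  and total \<open>1\<close>, so it is nonnegative. The last row, however, is the deficient one, with partial sums
  at most \<open>0\<close> and total \<open>0\<close>.\<close>

lemma residual_last_row_zero:
  assumes M: "M \<in> residual_DSASM (Suc m) (Suc m)" and "j \<le> m"
  shows "M $$ (m, j) = 0"
proof -
  have nonneg: "0 \<le> M $$ (m, j)" if "j < m" for j
  proof -
    have "row_prefix M j (Suc m) = 1" "row_prefix M j m \<in> {0, 1}"
      using that residual_DSASM_totalD[OF M, of j] residual_DSASM_prefixD[OF M, of j m] by auto
    then show ?thesis
      using that residual_DSASM_symD[OF M, of m j] entry_eq_row_prefix_diff[of M j m] by auto
  qed
  have "row_prefix M m m \<le> 0"
    using residual_DSASM_prefixD[OF M, of m m] by auto
  moreover have "0 \<le> row_prefix M m m"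
    unfolding row_prefix_def using nonneg by (intro sum_nonneg) simp
  ultimately have "row_prefix M m m = 0" by simp
  moreover from this have "M $$ (m, j) = 0" if "j < m" for j
    using that nonneg sum_nonneg_eq_0_iff[of "{..<m}" "\<lambda>j. M $$ (m, j)"]
    by (simp add: row_prefix_def)
  moreover have "row_prefix M m (Suc m) = 0"
    using residual_DSASM_totalD[OF M, of m] by simp
  ultimately show ?thesis using \<open>j \<le> m\<close> by (auto simp: row_prefix_Suc le_less)
qed

lemma bij_betw_zero_border:
  "bij_betw zero_border (DSASM m) (residual_DSASM (Suc m) (Suc m))"
proof (rule bij_betwI[where g = "\<lambda>M. mat m m (\<lambda>ij. M $$ ij)"])
  let ?g = "\<lambda>M :: int mat. mat m m (\<lambda>ij. M $$ ij)"
  have mem: "B \<in> DSASM m \<longleftrightarrow> zero_border B \<in> residual_DSASM (Suc m) (Suc m)"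
    if B: "B \<in> carrier_mat m m" for B
  proof -
    have "zero_border B \<in> carrier_mat (Suc m) (Suc m)" using B by (simp add: zero_border_def)
    then show ?thesis
      using B zero_border_index[OF B] row_prefix_zero_border[OF B]
      by (auto simp: DSASM_eq_residual residual_DSASM_def less_Suc_eq le_Suc_eq)
  qed
  show "zero_border \<in> DSASM m \<rightarrow> residual_DSASM (Suc m) (Suc m)"
    using mem by (auto simp: DSASM_def ASM_def)
  have inv: "zero_border (?g M) = M" if M: "M \<in> residual_DSASM (Suc m) (Suc m)" for M
  proof (rule eq_matI)
    have C: "M \<in> carrier_mat (Suc m) (Suc m)" using M by (simp add: residual_DSASM_def)
    then show "dim_row (zero_border (?g M)) = dim_row M" "dim_col (zero_border (?g M)) = dim_col M"
      by (auto simp: zero_border_def)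
    fix i j assume "i < dim_row M" "j < dim_col M"
    then show "zero_border (?g M) $$ (i, j) = M $$ (i, j)"
      using C residual_last_row_zero[OF M] residual_DSASM_symD[OF M, of i j]
      by (auto simp: zero_border_def less_Suc_eq)
  qed
  show "zero_border (?g M) = M" if "M \<in> residual_DSASM (Suc m) (Suc m)" for M
    using inv[OF that] .
  show "?g \<in> residual_DSASM (Suc m) (Suc m) \<rightarrow> DSASM m"
    using inv mem by (metis (no_types, lifting) Pi_I mat_carrier)
  show "?g (zero_border B) = B" if "B \<in> DSASM m" for B
    using that by (intro eq_matI) (auto simp: zero_border_def DSASM_def ASM_def)
qed

section \<open>Enumeration\<close>

lemma card_DSASM_first: "k \<le> m \<Longrightarrow> card (DSASM_first (Suc m) (Suc k)) = card (residual_DSASM m k)"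
  using bij_betw_same_card[OF bij_betw_border] by metis

lemma card_DSASM_first_1: "card (DSASM_first (Suc m) 1) = card (DSASM m)"
  using card_DSASM_first[of 0 m] by (simp add: DSASM_eq_residual)

lemma card_DSASM_first_2: "0 < m \<Longrightarrow> card (DSASM_first (Suc m) 2) = card (DSASM m)"
  using card_DSASM_first[of 1 m] bij_betw_same_card[OF bij_betw_residual_1, of m]
  by (simp add: numeral_2_eq_2)

lemma card_DSASM_first_last: "card (DSASM_first (Suc (Suc m)) (Suc (Suc m))) = card (DSASM m)"
  using card_DSASM_first[of "Suc m" "Suc m"] bij_betw_same_card[OF bij_betw_zero_border, of m]
  by simp

text \<open>The two classes of residual matrices correspond to DSASMs of size \<open>m + 1\<close> whose first \<open>1\<close> avoids
  column \<open>2\<close>, respectively columns \<open>1\<close> and \<open>2\<close> (numbered from \<open>1\<close>). Each of these columns accounts for \<open>|DSASM(m)|\<close>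
  matrices; for column \<open>2\<close> this needs \<open>m > 0\<close>.\<close>

lemma card_DSASM_first_3:
  assumes "0 < m"
  shows "int (card (DSASM_first (Suc (Suc m)) 3))
    = 2 * int (card (DSASM (Suc m))) - 3 * int (card (DSASM m))"
proof -
  let ?D = "DSASM (Suc m)" and ?M = "residual_DSASM (Suc m) 2"
  let ?F1 = "DSASM_first (Suc m) 1" and ?F2 = "DSASM_first (Suc m) 2"
  note fin = finite_DSASM[of "Suc m"]
  have sub: "?F1 \<subseteq> ?D" "?F2 \<subseteq> ?D" "?F1 \<inter> ?F2 = {}" by (auto simp: DSASM_first_def)
  then have finF: "finite ?F1" "finite ?F2" using fin finite_subset by blast+
  have iff: "B \<in> ?F1 \<longleftrightarrow> B $$ (0, 0) \<noteq> 0" "B \<in> ?F2 \<longleftrightarrow> B $$ (0, 1) \<noteq> 0" if "B \<in> ?D" for B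
    using that assms DSASM_first_iff_entry[of 0 "Suc m" B] DSASM_first_iff_entry[of 1 "Suc m" B]
    by (auto simp: numeral_2_eq_2)
  have "card {M \<in> ?M. M $$ (0, 1) = 0} = card {B \<in> ?D. B $$ (0, 1) = 0}"
    using bij_betw_same_card[OF bij_betw_residual_2_zero, of "Suc m"] assms by simp
  also have "{B \<in> ?D. B $$ (0, 1) = 0} = ?D - ?F2" using iff by auto
  finally have zero: "int (card {M \<in> ?M. M $$ (0, 1) = 0}) = int (card ?D) - int (card ?F2)"
    using sub fin finF by (simp add: card_Diff_subset card_mono of_nat_diff)
  have "card {M \<in> ?M. M $$ (0, 1) \<noteq> 0} = card {B \<in> ?D. B $$ (0, 0) = 0 \<and> B $$ (0, 1) = 0}"
    using bij_betw_same_card[OF bij_betw_residual_2_nonzero, of "Suc m"] assms by simp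
  also have "{B \<in> ?D. B $$ (0, 0) = 0 \<and> B $$ (0, 1) = 0} = ?D - (?F1 \<union> ?F2)" using iff by auto
  finally have nonzero: "int (card {M \<in> ?M. M $$ (0, 1) \<noteq> 0})
      = int (card ?D) - (int (card ?F1) + int (card ?F2))"
    using sub fin finF card_mono[OF fin, of "?F1 \<union> ?F2"]
    by (simp add: card_Diff_subset card_Un_disjoint of_nat_diff)
  have "?M = {M \<in> ?M. M $$ (0, 1) = 0} \<union> {M \<in> ?M. M $$ (0, 1) \<noteq> 0}" by auto
  then have "card ?M = card {M \<in> ?M. M $$ (0, 1) = 0} + card {M \<in> ?M. M $$ (0, 1) \<noteq> 0}"
    using finite_residual_DSASM[of 2 "Suc m"] assms
    by (subst card_Un_disjoint[symmetric]) auto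
  moreover have "card (DSASM_first (Suc (Suc m)) 3) = card ?M"
    using card_DSASM_first[of 2 "Suc m"] assms by (simp add: numeral_3_eq_3 numeral_2_eq_2)
  ultimately show ?thesis
    using zero nonzero card_DSASM_first_1[of m] card_DSASM_first_2[of m] assms by simp
qed

section \<open>Generating functions\<close>

definition weight :: "int mat \<Rightarrow> int poly poly" where
  "weight A = indet_r ^ R_stat A * indet_s ^ S_stat A"

lemma term_X_gf:
  "[:indet_r:] ^ R_stat A * [:indet_s:] ^ S_stat A * indet_t ^ T_stat A = monom (weight A) (T_stat A)"
proof -
  have "indet_t ^ k = monom 1 k" for k
    by (simp add: indet_t_def monom_altdef)
  then show ?thesis
    by (simp add: weight_def poly_const_pow smult_monom)
qed

lemma coeff_X_gf: "coeff (X_gf n) k = (\<Sum>A\<in>DSASM_first n k. weight A)"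
proof -
  have "coeff (X_gf n) k = (\<Sum>A\<in>DSASM n. if T_stat A = k then weight A else 0)"
    by (simp add: X_gf_def term_X_gf coeff_sum)
  then show ?thesis
    by (simp add: DSASM_first_def sum.inter_filter[OF finite_DSASM])
qed

lemma X_gf_at_1: "poly (X_gf n) 1 = (\<Sum>A\<in>DSASM n. weight A)"
  by (simp add: X_gf_def term_X_gf poly_sum poly_monom)

lemma int_R_stat: "int (R_stat A) = (\<Sum>j<dim_row A. \<Sum>i<j. \<bar>A $$ (i, j)\<bar>)"
  by (simp add: R_stat_def sum_nonneg)

lemma int_S_stat: "int (S_stat A) = (\<Sum>i<dim_row A. \<bar>A $$ (i, i)\<bar>)"
  by (simp add: S_stat_def sum_nonneg)

lemma R_stat_border:
  assumes M: "M \<in> carrier_mat m m" and "k \<le> m"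
  shows "R_stat (border k M) = of_bool (0 < k) + R_stat M"
proof -
  have "int (R_stat (border k M))
      = (\<Sum>j<m. \<bar>border k M $$ (0, Suc j)\<bar>) + (\<Sum>j<m. \<Sum>i<j. \<bar>border k M $$ (Suc i, Suc j)\<bar>)"
    using M carrier_matD(1)[OF border_in_carrier[OF M, of k]]
    by (simp add: int_R_stat sum.lessThan_Suc_shift sum.distrib del: sum.lessThan_Suc)
  also have "(\<Sum>j<m. \<bar>border k M $$ (0, Suc j)\<bar>) = (\<Sum>j<m. of_bool (Suc j = k))"
    using border_index(1)[OF M] by (intro sum.cong) auto
  also have "\<dots> = of_bool (0 < k)"
    using \<open>k \<le> m\<close> by (cases k) (auto simp: of_bool_def)
  also have "(\<Sum>j<m. \<Sum>i<j. \<bar>border k M $$ (Suc i, Suc j)\<bar>) = int (R_stat M)"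
    using M border_index(3)[OF M] by (simp add: int_R_stat)
  finally show ?thesis by (metis of_nat_add of_nat_eq_iff of_nat_of_bool)
qed

lemma S_stat_border:
  assumes M: "M \<in> carrier_mat m m"
  shows "S_stat (border k M) = of_bool (k = 0) + S_stat M"
proof -
  have "int (S_stat (border k M)) = int (of_bool (k = 0) + S_stat M)"
    using M carrier_matD(1)[OF border_in_carrier[OF M, of k]] border_index[OF M]
    by (simp add: int_S_stat sum.lessThan_Suc_shift del: sum.lessThan_Suc)
  then show ?thesis by linarith
qed

lemma coeff_X_gf_residual:
  assumes "0 < k" "k \<le> m"
  shows "coeff (X_gf (Suc m)) (Suc k) = indet_r * (\<Sum>M\<in>residual_DSASM m k. weight M)"
proof -
  have "coeff (X_gf (Suc m)) (Suc k) = (\<Sum>M\<in>residual_DSASM m k. weight (border k M))"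
    unfolding coeff_X_gf using sum.reindex_bij_betw[OF bij_betw_border[OF assms(2)], of weight] by simp
  also have "\<dots> = (\<Sum>M\<in>residual_DSASM m k. indet_r * weight M)"
    using assms by (intro sum.cong)
      (auto simp: weight_def residual_DSASM_def R_stat_border S_stat_border mult.assoc)
  finally show ?thesis by (simp add: sum_distrib_left)
qed

lemma coeff_X_gf_1: "coeff (X_gf (Suc m)) 1 = indet_s * poly (X_gf m) 1"
proof -
  have "coeff (X_gf (Suc m)) 1 = (\<Sum>M\<in>residual_DSASM m 0. weight (border 0 M))"
    unfolding coeff_X_gf using sum.reindex_bij_betw[OF bij_betw_border[of 0 m], of weight] by simp
  also have "\<dots> = (\<Sum>M\<in>residual_DSASM m 0. indet_s * weight M)"
    by (intro sum.cong)
      (auto simp: weight_def residual_DSASM_def R_stat_border S_stat_border mult_ac)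
  finally show ?thesis by (simp add: sum_distrib_left X_gf_at_1 DSASM_eq_residual)
qed

lemma weight_zero_border:
  assumes B: "B \<in> carrier_mat m m"
  shows "weight (zero_border B) = weight B"
proof -
  have d: "dim_row (zero_border B) = Suc m" "dim_row B = m"
    using B by (auto simp: zero_border_def)
  have "int (R_stat (zero_border B)) = int (R_stat B)" "int (S_stat (zero_border B)) = int (S_stat B)"
    using zero_border_index[OF B] by (simp_all add: int_R_stat int_S_stat d)
  then show ?thesis by (simp add: weight_def)
qed

lemma coeff_X_gf_last:
  "coeff (X_gf (Suc (Suc m))) (Suc (Suc m)) = indet_r * poly (X_gf m) 1"
proof -
  have "(\<Sum>M\<in>residual_DSASM (Suc m) (Suc m). weight M) = (\<Sum>B\<in>DSASM m. weight (zero_border B))"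
    using sum.reindex_bij_betw[OF bij_betw_zero_border, of weight m] by simp
  also have "\<dots> = poly (X_gf m) 1"
    unfolding X_gf_at_1
    by (intro sum.cong) (auto simp: DSASM_def ASM_def intro: weight_zero_border)
  finally show ?thesis using coeff_X_gf_residual[of "Suc m" "Suc m"] by simp
qed

text \<open>The corner entry of \<open>M\<close> is one less than that of \<open>B\<close>, so exactly one of the two vanishes, the other
  being \<open>1\<close> or \<open>-1\<close>. Each equation is oriented so that no
  negative power of \<open>s\<close> occurs.\<close>

lemma weight_add_corner:
  assumes M: "M \<in> carrier_mat (Suc m) (Suc m)"
  defines "B \<equiv> M + elem_mat (Suc m) 0 0"
  shows "B $$ (0, 0) = 1 \<Longrightarrow> weight B = indet_s * weight M"
    and "B $$ (0, 0) = 0 \<Longrightarrow> weight M = indet_s * weight B"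
proof -
  have d: "dim_row M = Suc m" "dim_row B = Suc m" using M by (auto simp: B_def)
  have corner: "M $$ (0, 0) = B $$ (0, 0) - 1" using M by (simp add: B_def)
  have "int (R_stat B) = int (R_stat M)"
    unfolding int_R_stat d by (intro sum.cong refl) (use M in \<open>auto simp: B_def\<close>)
  then have R: "R_stat B = R_stat M" by simp
  have "(\<Sum>i<m. \<bar>B $$ (Suc i, Suc i)\<bar>) = (\<Sum>i<m. \<bar>M $$ (Suc i, Suc i)\<bar>)"
    by (intro sum.cong refl) (use M in \<open>auto simp: B_def\<close>)
  then have S: "int (S_stat B) - \<bar>B $$ (0, 0)\<bar> = int (S_stat M) - \<bar>M $$ (0, 0)\<bar>"
    by (simp add: int_S_stat d sum.lessThan_Suc_shift del: sum.lessThan_Suc)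
  show "weight B = indet_s * weight M" if "B $$ (0, 0) = 1"
  proof -
    have "S_stat B = Suc (S_stat M)" using S corner that by simp
    then show ?thesis by (simp add: weight_def R mult_ac)
  qed
  show "weight M = indet_s * weight B" if "B $$ (0, 0) = 0"
  proof -
    have "S_stat M = Suc (S_stat B)" using S corner that by simp
    then show ?thesis by (simp add: weight_def R mult_ac)
  qed
qed

text \<open>By \<open>bij_betw_residual_1\<close> the residual matrices are \<open>B - E_00\<close> for \<open>B\<close> a DSASM of size \<open>m + 1\<close>. Those
  \<open>B\<close> with \<open>B_00 = 0\<close> contribute \<open>s\<close> times their weight. The remaining \<open>B\<close> have total weight
  \<open>s X_m(r, s, 1)\<close> and lose one factor \<open>s\<close>, so they contribute \<open>X_m(r, s, 1)\<close>; this cancellation is possible because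
  the polynomial ring is an integral domain.\<close>

lemma coeff_X_gf_2:
  "coeff (X_gf (Suc (Suc m))) 2 = indet_r * indet_s * poly (X_gf (Suc m)) 1
     + indet_r * (1 - indet_s ^ 2) * poly (X_gf m) 1"
proof -
  let ?D = "DSASM (Suc m)" and ?F = "DSASM_first (Suc m) 1" and ?E = "elem_mat (Suc m) 0 0"
  let ?M = "residual_DSASM (Suc m) 1"
  let ?w = "\<lambda>B. weight (B - ?E)"
  have sub: "?F \<subseteq> ?D" by (auto simp: DSASM_first_def)
  have sumF: "(\<Sum>B\<in>?F. weight B) = indet_s * poly (X_gf m) 1"
    using coeff_X_gf_1[of m] by (simp add: coeff_X_gf)
  have car: "B - ?E \<in> carrier_mat (Suc m) (Suc m) \<and> (B - ?E) + ?E = B" if "B \<in> ?D" for B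
    using that by (auto simp: DSASM_def ASM_def intro!: eq_matI)
  have iff: "B $$ (0, 0) = of_bool (B \<in> ?F)" if "B \<in> ?D" for B
    using that DSASM_first_iff_entry[of 0 "Suc m" B] by auto
  have "(\<Sum>M\<in>?M. weight M) = (\<Sum>M\<in>?M. ?w (M + ?E))"
  proof (intro sum.cong refl)
    fix M assume "M \<in> ?M"
    then have "(M + ?E) - ?E = M" by (auto simp: residual_DSASM_def intro!: eq_matI)
    then show "weight M = ?w (M + ?E)" by simp
  qed
  also have "\<dots> = (\<Sum>B\<in>?D. ?w B)"
    using sum.reindex_bij_betw[OF bij_betw_residual_1, of "Suc m" ?w] by simp
  also have "\<dots> = (\<Sum>B\<in>?D - ?F. ?w B) + (\<Sum>B\<in>?F. ?w B)"
    by (rule sum.subset_diff[OF sub finite_DSASM])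
  finally have total: "(\<Sum>M\<in>?M. weight M) = (\<Sum>B\<in>?D - ?F. ?w B) + (\<Sum>B\<in>?F. ?w B)" .
  have "indet_s * (\<Sum>B\<in>?F. ?w B) = (\<Sum>B\<in>?F. weight B)"
    unfolding sum_distrib_left
  proof (intro sum.cong refl)
    fix B assume "B \<in> ?F"
    then show "indet_s * ?w B = weight B"
      using weight_add_corner(1)[of "B - ?E" m] car[of B] iff[of B] sub by auto
  qed
  then have "(\<Sum>B\<in>?F. ?w B) = poly (X_gf m) 1"
    using sumF by (simp add: indet_s_def)
  moreover have "(\<Sum>B\<in>?D - ?F. ?w B) = (\<Sum>B\<in>?D - ?F. indet_s * weight B)"
  proof (intro sum.cong refl)
    fix B assume "B \<in> ?D - ?F"
    then show "?w B = indet_s * weight B"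
      using weight_add_corner(2)[of "B - ?E" m] car[of B] iff[of B] by auto
  qed
  moreover have "(\<Sum>B\<in>?D - ?F. weight B) = poly (X_gf (Suc m)) 1 - indet_s * poly (X_gf m) 1"
    using sum_diff[OF finite_DSASM sub, of weight] sumF by (simp add: X_gf_at_1)
  ultimately have sumM: "(\<Sum>M\<in>?M. weight M)
      = indet_s * (poly (X_gf (Suc m)) 1 - indet_s * poly (X_gf m) 1) + poly (X_gf m) 1"
    using total by (simp add: sum_distrib_left[symmetric])
  have "coeff (X_gf (Suc (Suc m))) 2 = indet_r * (\<Sum>M\<in>?M. weight M)"
    using coeff_X_gf_residual[of 1 "Suc m"] by (simp add: numeral_2_eq_2)
  then show ?thesis unfolding sumM by (simp add: algebra_simps power2_eq_square)
qed

theorem proposition3p1: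
  fixes n :: nat
  shows "(n \<ge> 2 \<longrightarrow> card (DSASM_first n 1) = card (DSASM (n - 1))) \<and>
    (n \<ge> 2 \<longrightarrow> card (DSASM_first n 2) = card (DSASM (n - 1))) \<and>
    (n \<ge> 3 \<longrightarrow> card (DSASM_first n n) = card (DSASM (n - 2))) \<and>
    (n \<ge> 3 \<longrightarrow> int (card (DSASM_first n 3)) =
       2 * int (card (DSASM (n - 1))) - 3 * int (card (DSASM (n - 2)))) \<and>
    (n \<ge> 2 \<longrightarrow> coeff (X_gf n) 1 = indet_s * poly (X_gf (n - 1)) 1) \<and>
    (n \<ge> 3 \<longrightarrow> coeff (X_gf n) 2 =
       indet_r * indet_s * poly (X_gf (n - 1)) 1
       + indet_r * (1 - indet_s ^ 2) * poly (X_gf (n - 2)) 1) \<and>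
    (n \<ge> 3 \<longrightarrow> coeff (X_gf n) n = indet_r * poly (X_gf (n - 2)) 1)"
proof (cases "n \<ge> 2")
  case True
  then obtain m where n: "n = Suc (Suc m)" by (metis add_2_eq_Suc le_Suc_ex)
  show ?thesis
    using card_DSASM_first_1[of "Suc m"] card_DSASM_first_2[of "Suc m"] card_DSASM_first_last[of m]
      card_DSASM_first_3[of m] coeff_X_gf_1[of "Suc m"] coeff_X_gf_2[of m] coeff_X_gf_last[of m]
    by (auto simp: n)
qed simp

end
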